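(* Let $\mathbf{k}$ be a field of characteristic zero, let $L$ be a DG Lie algebra over $\mathbf{k}$, let $\mathfrak{g}$ be a Lie algebra over $\mathbf{k}$ (seen as a DG Lie algebra concentrated in degree zero), and let $\epsilon:L\to\mathfrak{g}$ be an augmentation, i.e. a morphism of DG Lie algebras. Then the Fiorenza–Manetti deformation functor $\mathrm{Def}^{\mathrm{FM}}_\epsilon$ associated to the mapping cone of $\epsilon:L\to M$ with $M=\mathfrak{g}$ coincides with the Eyssidieux–Simpson augmented deformation functor $\mathrm{Def}_{L,\epsilon}$, as functors from local Artin $\mathbf{k}$-algebras to sets.
   Context: A local Artin algebra over $\mathbf{k}$ is a finite-dimensional local commutative $\mathbf{k}$-algebra $A$ with maximal ideal $\mathfrak{m}_A$ and residue field $\mathbf{k}$; these form a category $\mathbf{Art}_{\mathbf{k}}$ (local morphisms). For a DG Lie algebra $L$, $L\otimes\mathfrak{m}_A$ is a nilpotent DG Lie algebra with $[u\otimes a,v\otimes b]=[u,v]\otimes ab$, $d(u\otimes a)=d(u)\otimes a$. The group $\exp(L^0\otimes\mathfrak{m}_A)$ is the set of symbols $e^\alpha$, $\alpha\in L^0\otimes\mathfrak{m}_A$, with product $*$ given by the Baker–Campbell–Hausdorff formula. It acts on $L^1\otimes\mathfrak{m}_A$, preserving the Maurer–Cartan elements, by gauge transformations $e^\lambda.x=x+\sum_{n\ge0}\frac{\mathrm{ad}_\lambda^n}{(n+1)!}([\lambda,x]-d\lambda)$. **Augmented deformation functor (Eyssidieux–Simpson).** $\mathrm{Def}_{L,\epsilon}(A)$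 is the quotient of $$\left\{(x,e^\alpha)\in(L^1\otimes\mathfrak{m}_A)\times\exp(\mathfrak{g}\otimes\mathfrak{m}_A)\ \middle|\ d(x)+\tfrac12[x,x]=0\right\}$$ by the left action of $\exp(L^0\otimes\mathfrak{m}_A)$ given by $e^\lambda.(x,e^\alpha)=(e^\lambda.x,\ e^\alpha*e^{-\epsilon(\lambda)})$. **Deformation functor of the cone (Fiorenza–Manetti).** For a morphism $\epsilon:L\to M$ of DG Lie algebras, the desuspended mapping cone of $\epsilon$ has a canonical $L_\infty$ algebra structure, whose associated deformation functor is (isomorphic to) the functor $\mathrm{Def}^{\mathrm{FM}}_\epsilon$ sending $A$ to the quotient of $$\left\{(x,e^\alpha)\in(L^1\otimes\mathfrak{m}_A)\times\exp(M^0\otimes\mathfrak{m}_A)\ \middle|\ d(x)+\tfrac12[x,x]=0,\ e^\alpha*\epsilon(x)=0\right\}$$ (here $e^\alpha*\epsilon(x)$ denotes the gauge action of $e^\alpha$ on $\epsilon(x)\in M^1\otimes\mathfrak{m}_A$) by the relation: $(x,e^\alpha)\sim(y,e^\beta)$ if and only if there exists $(\lambda,\mu)\in(L^0\otimes\mathfrak{m}_A)\times(M^{-1}\otimes\mathfrak{m}_A)$ with $e^\lambda.x=y$ and $e^\beta=e^{d(\mu)}*e^\alpha*e^{-\epsilon(\lambda)}$. *)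

theory Defs
  imports Complex_Main "HOL-Library.Function_Algebras" "HOL-Library.Groups_Big_Fun"
begin

section \<open>Tensor products over a field\<close>

definition bilin ::
  "('k::field \<Rightarrow> 'v::ab_group_add \<Rightarrow> 'v) \<Rightarrow> ('k \<Rightarrow> 'w::ab_group_add \<Rightarrow> 'w) \<Rightarrow>
   ('k \<Rightarrow> 'x::ab_group_add \<Rightarrow> 'x) \<Rightarrow> ('v \<Rightarrow> 'w \<Rightarrow> 'x) \<Rightarrow> bool"
  where "bilin sV sW sX f \<longleftrightarrow>
    (\<forall>v. Vector_Spaces.linear sW sX (f v)) \<and> (\<forall>w. Vector_Spaces.linear sV sX (\<lambda>v. f v w))"

text \<open>
  The library has no tensor product of vector spaces. The tensor product of \<open>V\<close> and \<open>W\<close> over the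
  field \<open>k\<close> is realised inside the dual of the space of bilinear forms on \<open>V \<times> W\<close>: the pure tensor
  of \<open>v\<close> and \<open>w\<close> is evaluation of bilinear forms at \<open>(v, w)\<close>, and tensors are linear combinations
  of pure tensors. Functionals are extended by 0 to functions that are not bilinear forms.
  The universal property is stated by lemmas \<open>tensor_universal\<close> and \<open>tensor_universal_unique\<close>.
\<close>

type_synonym ('k, 'v, 'w) tens = "('v \<Rightarrow> 'w \<Rightarrow> 'k) \<Rightarrow> 'k"

definition tens_scale :: "'k::field \<Rightarrow> ('k, 'v, 'w) tens \<Rightarrow> ('k, 'v, 'w) tens"
  where "tens_scale c t = (\<lambda>B. c * t B)"

definition pure_tensor ::
  "('k::field \<Rightarrow> 'v::ab_group_add \<Rightarrow> 'v) \<Rightarrow> ('k \<Rightarrow> 'w::ab_group_add \<Rightarrow> 'w) \<Rightarrow>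
   'v \<Rightarrow> 'w \<Rightarrow> ('k, 'v, 'w) tens"
  where "pure_tensor sV sW v w = (\<lambda>B. if bilin sV sW (*) B then B v w else 0)"

text \<open>
  For subspaces \<open>V'\<close> of \<open>V\<close> and \<open>W'\<close> of \<open>W\<close>, the tensor product of \<open>V'\<close> and \<open>W'\<close> is identified
  with its image in the tensor product of \<open>V\<close> and \<open>W\<close> (over a field the comparison map is injective).
\<close>

definition tensor_space ::
  "('k::field \<Rightarrow> 'v::ab_group_add \<Rightarrow> 'v) \<Rightarrow> ('k \<Rightarrow> 'w::ab_group_add \<Rightarrow> 'w) \<Rightarrow>
   'v set \<Rightarrow> 'w set \<Rightarrow> ('k, 'v, 'w) tens set"
  where "tensor_space sV sW V W =
    module.span tens_scale {pure_tensor sV sW v w | v w. v \<in> V \<and> w \<in> W}"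

text \<open>
  The map induced on tensor products by linear maps \<open>f\<close> and \<open>g\<close> (the scalar multiplications are
  those of the target spaces).
\<close>

definition tensor_map ::
  "('k::field \<Rightarrow> 'v'::ab_group_add \<Rightarrow> 'v') \<Rightarrow> ('k \<Rightarrow> 'w'::ab_group_add \<Rightarrow> 'w') \<Rightarrow>
   ('v \<Rightarrow> 'v') \<Rightarrow> ('w \<Rightarrow> 'w') \<Rightarrow> ('k, 'v, 'w) tens \<Rightarrow> ('k, 'v', 'w') tens"
  where "tensor_map sV sW f g t =
    (\<lambda>B. if bilin sV sW (*) B then t (\<lambda>v w. B (f v) (g w)) else 0)"

text \<open>
  Bilinear extension of \<open>[u \<otimes> a, v \<otimes> b] = [u, v] \<otimes> a b\<close>, see lemma \<open>tensor_bracket_pure\<close>.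
\<close>

definition tensor_bracket ::
  "('k::field \<Rightarrow> 'v::ab_group_add \<Rightarrow> 'v) \<Rightarrow> ('k \<Rightarrow> 'a::comm_ring_1 \<Rightarrow> 'a) \<Rightarrow>
   ('v \<Rightarrow> 'v \<Rightarrow> 'v) \<Rightarrow> ('k, 'v, 'a) tens \<Rightarrow> ('k, 'v, 'a) tens \<Rightarrow> ('k, 'v, 'a) tens"
  where "tensor_bracket sV sA br s t =
    (\<lambda>B. if bilin sV sA (*) B then s (\<lambda>u a. t (\<lambda>v b. B (br u v) (a * b))) else 0)"

lemma vector_space_tens_scale: "vector_space (tens_scale :: 'k::field \<Rightarrow> _ \<Rightarrow> ('k, 'v, 'w) tens)"
  by unfold_locales (auto simp: tens_scale_def fun_eq_iff plus_fun_def algebra_simps)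

lemma vector_space_mult: "vector_space ((*) :: 'k::field \<Rightarrow> 'k \<Rightarrow> 'k)"
  by unfold_locales (auto simp: algebra_simps)

lemma linearI':
  assumes "vector_space s1" "vector_space s2"
    and "\<And>x y. f (x + y) = f x + f y" "\<And>c x. f (s1 c x) = s2 c (f x)"
  shows "Vector_Spaces.linear s1 s2 f"
proof -
  interpret vector_space_pair s1 s2 using assms(1,2) by (simp add: vector_space_pair_def)
  show ?thesis by unfold_locales (use assms(3,4) in auto)
qed

lemma linearD:
  assumes "Vector_Spaces.linear s1 s2 f"
  shows "f (x + y) = f x + f y" "f (s1 c x) = s2 c (f x)"
    "vector_space s1" "vector_space s2" "f 0 = 0"
proof -
  interpret Vector_Spaces.linear s1 s2 f by fact
  show "f (x + y) = f x + f y" by (rule add)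
  show "f (s1 c x) = s2 c (f x)" by (rule scale)
  show "f 0 = 0" by (rule zero)
  show "vector_space s1" by (rule vs1.vector_space_axioms)
  show "vector_space s2" by (rule vs2.vector_space_axioms)
qed

lemma bilinD:
  assumes "bilin sV sW sX f"
  shows "f (v + v') w = f v w + f v' w" "f v (w + w') = f v w + f v w'"
    "f (sV c v) w = sX c (f v w)" "f v (sW c w) = sX c (f v w)"
    "vector_space sV" "vector_space sW" "vector_space sX"
proof -
  have l: "Vector_Spaces.linear sW sX (f v)" and r: "Vector_Spaces.linear sV sX (\<lambda>v. f v w)" for v w
    using assms by (auto simp: bilin_def)
  show "f (v + v') w = f v w + f v' w" by (rule linearD(1)[OF r])
  show "f v (w + w') = f v w + f v w'" by (rule linearD(1)[OF l])
  show "f (sV c v) w = sX c (f v w)" by (rule linearD(2)[OF r])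
  show "f v (sW c w) = sX c (f v w)" by (rule linearD(2)[OF l])
  show "vector_space sV" by (rule linearD(3)[OF r])
  show "vector_space sW" by (rule linearD(3)[OF l])
  show "vector_space sX" by (rule linearD(4)[OF l])
qed

lemma linear_comp:
  assumes "Vector_Spaces.linear s1 s2 f" "Vector_Spaces.linear s2 s3 g"
  shows "Vector_Spaces.linear s1 s3 (\<lambda>x. g (f x))"
  by (rule linearI')
    (simp_all only: linearD(1)[OF assms(1)] linearD(2)[OF assms(1)] linearD(3)[OF assms(1)]
      linearD(1)[OF assms(2)] linearD(2)[OF assms(2)] linearD(4)[OF assms(2)])

lemma bilin_pure_tensor:
  assumes "vector_space sV" "vector_space sW"
  shows "bilin sV sW tens_scale (pure_tensor sV sW)"
proof -
  let ?p = "pure_tensor sV sW"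
  have "?p (v + v') w = ?p v w + ?p v' w" "?p v (w + w') = ?p v w + ?p v w'"
    "?p (sV c v) w = tens_scale c (?p v w)" "?p v (sW c w) = tens_scale c (?p v w)" for v v' w w' c
    by (simp_all add: pure_tensor_def fun_eq_iff plus_fun_def tens_scale_def
        bilinD(1)[of sV sW "(*)"] bilinD(2)[of sV sW "(*)"] bilinD(3)[of sV sW "(*)"]
        bilinD(4)[of sV sW "(*)"])
  then show ?thesis
    unfolding bilin_def by (intro conjI allI linearI' assms vector_space_tens_scale)
qed

lemma linear_eval_tensor:
  "Vector_Spaces.linear tens_scale (*) (\<lambda>t :: ('k::field, 'v, 'w) tens. t B)"
  by (rule linearI'[OF vector_space_tens_scale vector_space_mult])
    (simp_all add: plus_fun_def tens_scale_def)

lemma linear_functional_separates: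
  fixes s :: "'k::field \<Rightarrow> 'x::ab_group_add \<Rightarrow> 'x"
  assumes "vector_space s" "\<And>f. Vector_Spaces.linear s (*) f \<Longrightarrow> f x = f y"
  shows "x = y"
proof (rule ccontr)
  assume ne: "x \<noteq> y"
  interpret vector_space_pair s "(*) :: 'k \<Rightarrow> 'k \<Rightarrow> 'k"
    using assms(1) vector_space_mult by (simp add: vector_space_pair_def)
  have "vs1.independent {x - y}" using ne by (simp add: vs1.dependent_single)
  then obtain f where f: "Vector_Spaces.linear s (*) f" "f (x - y) = 1"
    using linear_independent_extend[of "{x - y}" "\<lambda>_. 1"] by auto
  have "f x = f (x - y) + f y" using linearD(1)[OF f(1), of "x - y" y] by simp
  with assms(2)[OF f(1)] f(2) show False by simp
qed

lemma tensor_universal: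
  fixes sV :: "'k::field \<Rightarrow> 'v::ab_group_add \<Rightarrow> 'v" and sW :: "'k \<Rightarrow> 'w::ab_group_add \<Rightarrow> 'w"
    and sX :: "'k \<Rightarrow> 'x::ab_group_add \<Rightarrow> 'x"
  assumes "bilin sV sW sX f"
  shows "\<exists>h. Vector_Spaces.linear tens_scale sX h \<and> (\<forall>v w. h (pure_tensor sV sW v w) = f v w)"
proof -
  interpret P: vector_space_pair "tens_scale :: 'k \<Rightarrow> _ \<Rightarrow> ('k, 'v, 'w) tens" sX
    by (rule vector_space_pair.intro[OF vector_space_tens_scale bilinD(7)[OF assms]])
  interpret Q: vector_space_pair "tens_scale :: 'k \<Rightarrow> _ \<Rightarrow> ('k, 'v, 'w) tens" "(*) :: 'k \<Rightarrow> 'k \<Rightarrow> 'k"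
    by (rule vector_space_pair.intro[OF vector_space_tens_scale vector_space_mult])
  define S where "S = {pure_tensor sV sW v w | v w. True}"
  obtain D where D: "D \<subseteq> S" "P.vs1.independent D" "S \<subseteq> P.vs1.span D"
    using P.vs1.maximal_independent_subset by blast
  have "\<forall>b\<in>D. \<exists>p. b = pure_tensor sV sW (fst p) (snd p)" using D(1) by (auto simp: S_def)
  from bchoice[OF this] obtain p
    where p: "\<And>b. b \<in> D \<Longrightarrow> b = pure_tensor sV sW (fst (p b)) (snd (p b))" by blast
  obtain h where h: "Vector_Spaces.linear tens_scale sX h" "\<And>b. b \<in> D \<Longrightarrow> h b = f (fst (p b)) (snd (p b))"
    using P.linear_independent_extend[OF D(2), of "\<lambda>b. f (fst (p b)) (snd (p b))"] by blast
  have "h (pure_tensor sV sW v w) = f v w" for v w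
  proof (rule linear_functional_separates[OF bilinD(7)[OF assms]])
    fix \<phi> assume \<phi>: "Vector_Spaces.linear sX (*) \<phi>"
    define B where "B = (\<lambda>v w. \<phi> (f v w))"
    have B: "bilin sV sW (*) B" unfolding B_def bilin_def
      using assms[unfolded bilin_def] by (intro conjI allI linear_comp[OF _ \<phi>]) auto
    have "\<phi> (h t) = t B" if "t \<in> P.vs1.span D" for t
    proof (rule Q.linear_eq_on[OF linear_comp[OF h(1) \<phi>] linear_eval_tensor that])
      fix b assume b: "b \<in> D"
      have "b B = pure_tensor sV sW (fst (p b)) (snd (p b)) B" using p[OF b] by simp
      also have "\<dots> = \<phi> (h b)" using B h(2)[OF b] by (simp add: pure_tensor_def B_def)
      finally show "\<phi> (h b) = b B" by simp
    qed
    moreover have "pure_tensor sV sW v w \<in> P.vs1.span D" using D(3) by (auto simp: S_def)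
    ultimately show "\<phi> (h (pure_tensor sV sW v w)) = \<phi> (f v w)"
      using B by (simp add: pure_tensor_def B_def)
  qed
  with h(1) show "\<exists>h. Vector_Spaces.linear tens_scale sX h \<and> (\<forall>v w. h (pure_tensor sV sW v w) = f v w)"
    by blast
qed

lemma tensor_universal_unique:
  fixes sV :: "'k::field \<Rightarrow> 'v::ab_group_add \<Rightarrow> 'v" and sW :: "'k \<Rightarrow> 'w::ab_group_add \<Rightarrow> 'w"
    and sX :: "'k \<Rightarrow> 'x::ab_group_add \<Rightarrow> 'x"
  assumes h: "Vector_Spaces.linear tens_scale sX h" "Vector_Spaces.linear tens_scale sX h'"
    and eq: "\<And>v w. h (pure_tensor sV sW v w) = h' (pure_tensor sV sW v w)"
    and t: "t \<in> tensor_space sV sW UNIV UNIV"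
  shows "h t = h' t"
proof -
  interpret vector_space_pair "tens_scale :: 'k \<Rightarrow> _ \<Rightarrow> ('k, 'v, 'w) tens" sX
    by (rule vector_space_pair.intro[OF linearD(3,4)[OF h(1)]])
  show ?thesis
    by (rule linear_eq_on[OF h t[unfolded tensor_space_def]]) (use eq in blast)
qed

lemma tensor_map_pure:
  assumes "Vector_Spaces.linear sV sV' f" "Vector_Spaces.linear sW sW' g"
  shows "tensor_map sV' sW' f g (pure_tensor sV sW v w) = pure_tensor sV' sW' (f v) (g w)"
proof -
  have "bilin sV sW (*) (\<lambda>v w. B (f v) (g w))" if "bilin sV' sW' (*) B" for B
    using that assms unfolding bilin_def by (auto intro: linear_comp)
  then show ?thesis by (auto simp: tensor_map_def pure_tensor_def fun_eq_iff)
qed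

lemma tensor_bracket_pure:
  assumes br: "bilin sV sV sV br" and sA: "vector_space sA"
    and alg: "\<And>c a b. sA c (a * b) = sA c a * b"
  shows "tensor_bracket sV sA br (pure_tensor sV sA u a) (pure_tensor sV sA v b) =
    pure_tensor sV sA (br u v) (a * b)"
proof -
  have alg': "a * sA c b = sA c a * b" for c a b
    using alg[of c b a] alg[of c a b] by (simp add: mult.commute)
  have "bilin sV sA (*) (\<lambda>v b. B (br u v) (a * b))" "bilin sV sA (*) (\<lambda>u a. B (br u v) (a * b))"
    if B: "bilin sV sA (*) B" for B u a v b
  proof -
    have 1: "Vector_Spaces.linear sV sV (br u)" "Vector_Spaces.linear sV sV (\<lambda>u. br u v)"
      "Vector_Spaces.linear sA (*) (B v)" "Vector_Spaces.linear sV (*) (\<lambda>v. B v a)" for u v a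
      using br B by (auto simp: bilin_def)
    have 2: "Vector_Spaces.linear sA sA (\<lambda>b. a * b)" "Vector_Spaces.linear sA sA (\<lambda>a. a * b)" for a b
      by (rule linearI'; simp only: sA alg alg' distrib_left distrib_right)+
    show "bilin sV sA (*) (\<lambda>v b. B (br u v) (a * b))"
      unfolding bilin_def
      by (intro conjI allI linear_comp[OF 2(1) 1(3)] linear_comp[OF 1(1) 1(4)])
    show "bilin sV sA (*) (\<lambda>u a. B (br u v) (a * b))"
      unfolding bilin_def
      by (intro conjI allI linear_comp[OF 2(2) 1(3)] linear_comp[OF 1(2) 1(4)])
  qed
  then show ?thesis by (simp add: tensor_bracket_def pure_tensor_def fun_eq_iff)
qed

lemma linear_tensor_map: "Vector_Spaces.linear tens_scale tens_scale (tensor_map sV sW f g)"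
  by (rule linearI'[OF vector_space_tens_scale vector_space_tens_scale])
    (simp_all add: tensor_map_def fun_eq_iff plus_fun_def tens_scale_def)


section \<open>DG Lie algebras\<close>

text \<open>
  The carrier type is the total space, the direct sum of the subspaces \<open>deg L i\<close> for integers \<open>i\<close>.
\<close>

record ('k, 'v) dgla =
  scl :: "'k \<Rightarrow> 'v \<Rightarrow> 'v"
  deg :: "int \<Rightarrow> 'v set"
  brk :: "'v \<Rightarrow> 'v \<Rightarrow> 'v"
  dif :: "'v \<Rightarrow> 'v"

definition dg_lie_algebra :: "('k::field, 'v::ab_group_add) dgla \<Rightarrow> bool"
  where "dg_lie_algebra L \<longleftrightarrow>
    vector_space (scl L) \<and>
    (\<forall>i. module.subspace (scl L) (deg L i)) \<and>
    (\<forall>x. \<exists>!c. (\<forall>i. c i \<in> deg L i) \<and> finite {i. c i \<noteq> 0} \<and> (\<Sum>i | c i \<noteq> 0. c i) = x) \<and>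
    bilin (scl L) (scl L) (scl L) (brk L) \<and>
    (\<forall>i j. \<forall>x\<in>deg L i. \<forall>y\<in>deg L j. brk L x y \<in> deg L (i + j)) \<and>
    (\<forall>i j. \<forall>x\<in>deg L i. \<forall>y\<in>deg L j. brk L x y = scl L (- ((-1) powi (i * j))) (brk L y x)) \<and>
    (\<forall>i j. \<forall>x\<in>deg L i. \<forall>y\<in>deg L j. \<forall>z.
      brk L x (brk L y z) = brk L (brk L x y) z + scl L ((-1) powi (i * j)) (brk L y (brk L x z))) \<and>
    Vector_Spaces.linear (scl L) (scl L) (dif L) \<and>
    (\<forall>i. \<forall>x\<in>deg L i. dif L x \<in> deg L (i + 1)) \<and>
    (\<forall>x. dif L (dif L x) = 0) \<and>
    (\<forall>i. \<forall>x\<in>deg L i. \<forall>y.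
      dif L (brk L x y) = brk L (dif L x) y + scl L ((-1) powi i) (brk L x (dif L y)))"

definition dg_lie_hom ::
  "('k::field, 'v::ab_group_add) dgla \<Rightarrow> ('k, 'w::ab_group_add) dgla \<Rightarrow> ('v \<Rightarrow> 'w) \<Rightarrow> bool"
  where "dg_lie_hom L M f \<longleftrightarrow>
    Vector_Spaces.linear (scl L) (scl M) f \<and>
    (\<forall>i. \<forall>x\<in>deg L i. f x \<in> deg M i) \<and>
    (\<forall>x y. f (brk L x y) = brk M (f x) (f y)) \<and>
    (\<forall>x. f (dif L x) = dif M (f x))"

record ('k, 'v) lie_alg =
  lscl :: "'k \<Rightarrow> 'v \<Rightarrow> 'v"
  lbrk :: "'v \<Rightarrow> 'v \<Rightarrow> 'v"

definition lie_algebra :: "('k::field, 'v::ab_group_add) lie_alg \<Rightarrow> bool"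
  where "lie_algebra \<gg> \<longleftrightarrow>
    vector_space (lscl \<gg>) \<and>
    bilin (lscl \<gg>) (lscl \<gg>) (lscl \<gg>) (lbrk \<gg>) \<and>
    (\<forall>x. lbrk \<gg> x x = 0) \<and>
    (\<forall>x y z. lbrk \<gg> x (lbrk \<gg> y z) + lbrk \<gg> y (lbrk \<gg> z x) + lbrk \<gg> z (lbrk \<gg> x y) = 0)"

definition dg_of_lie :: "('k, 'v::zero) lie_alg \<Rightarrow> ('k, 'v) dgla"
  where "dg_of_lie \<gg> =
    \<lparr>scl = lscl \<gg>, deg = (\<lambda>i. if i = 0 then UNIV else {0}), brk = lbrk \<gg>, dif = (\<lambda>_. 0)\<rparr>"


section \<open>Local Artin algebras\<close>

definition ring_ideal :: "'a::comm_ring_1 set \<Rightarrow> bool"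
  where "ring_ideal I \<longleftrightarrow> 0 \<in> I \<and> (\<forall>x\<in>I. \<forall>y\<in>I. x + y \<in> I) \<and> (\<forall>r. \<forall>x\<in>I. r * x \<in> I)"

definition max_ideal :: "'a::comm_ring_1 set \<Rightarrow> bool"
  where "max_ideal I \<longleftrightarrow>
    ring_ideal I \<and> I \<noteq> UNIV \<and> (\<forall>J. ring_ideal J \<and> I \<subseteq> J \<and> J \<noteq> UNIV \<longrightarrow> J = I)"

text \<open>Meaningful only when the ring is local.\<close>

definition the_max :: "'a::comm_ring_1 set"
  where "the_max = (THE I. max_ideal I)"

text \<open>
  The ring structure is that of the type, the \<open>k\<close>-vector space structure is \<open>sA\<close>.
  The last conjunct says that the structure map from \<open>k\<close> to the residue field is bijective.
\<close>

definition local_artin_algebra :: "('k::field \<Rightarrow> 'a::comm_ring_1 \<Rightarrow> 'a) \<Rightarrow> bool"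
  where "local_artin_algebra sA \<longleftrightarrow>
    (\<exists>Basis. finite_dimensional_vector_space sA Basis) \<and>
    (\<forall>c a b. sA c (a * b) = sA c a * b) \<and>
    (\<exists>!I :: 'a set. max_ideal I) \<and>
    (\<forall>a. \<exists>!c. a - sA c 1 \<in> the_max)"

definition local_artin_hom ::
  "('k::field \<Rightarrow> 'a::comm_ring_1 \<Rightarrow> 'a) \<Rightarrow> ('k \<Rightarrow> 'b::comm_ring_1 \<Rightarrow> 'b) \<Rightarrow> ('a \<Rightarrow> 'b) \<Rightarrow> bool"
  where "local_artin_hom sA sB \<phi> \<longleftrightarrow>
    Vector_Spaces.linear sA sB \<phi> \<and> \<phi> 1 = 1 \<and> (\<forall>a b. \<phi> (a * b) = \<phi> a * \<phi> b) \<and>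
    \<phi> ` the_max \<subseteq> the_max"


section \<open>Baker--Campbell--Hausdorff product and gauge action\<close>

fun nested_bracket :: "('v::zero \<Rightarrow> 'v \<Rightarrow> 'v) \<Rightarrow> 'v list \<Rightarrow> 'v"
  where
    "nested_bracket br [] = 0"
  | "nested_bracket br [x] = x"
  | "nested_bracket br (x # y # zs) = br x (nested_bracket br (y # zs))"

text \<open>
  Dynkin's formula: the homogeneous component of degree \<open>N\<close> of \<open>log (exp x exp y)\<close> is the sum over
  all \<open>n \<ge> 1\<close> and all pairs \<open>(r\<^sub>i, s\<^sub>i) \<noteq> (0, 0)\<close>, \<open>1 \<le> i \<le> n\<close>, with \<open>\<Sum>\<^sub>i (r\<^sub>i + s\<^sub>i) = N\<close>, of
  \<open>(-1)^(n-1) / n * 1 / (N * \<Prod>\<^sub>i r\<^sub>i! s\<^sub>i!)\<close> times the right-nested bracket of the word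
  \<open>x^r\<^sub>1 y^s\<^sub>1 \<dots> x^r\<^sub>n y^s\<^sub>n\<close>. The component of degree \<open>0\<close> is \<open>0\<close>.
\<close>

definition bch_component ::
  "('k::field_char_0 \<Rightarrow> 'v::ab_group_add \<Rightarrow> 'v) \<Rightarrow> ('v \<Rightarrow> 'v \<Rightarrow> 'v) \<Rightarrow> nat \<Rightarrow> 'v \<Rightarrow> 'v \<Rightarrow> 'v"
  where "bch_component sV br N x y =
    (\<Sum>ps \<in> {ps :: (nat \<times> nat) list. (0, 0) \<notin> set ps \<and> (\<Sum>(r, s)\<leftarrow>ps. r + s) = N}.
      sV ((-1) ^ (length ps - 1) /
          (of_nat (length ps) * of_nat N * (\<Prod>(r, s)\<leftarrow>ps. fact r * fact s)))
        (nested_bracket br (concat (map (\<lambda>(r, s). replicate r x @ replicate s y) ps))))"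

text \<open>
  In a nilpotent Lie algebra only finitely many components are nonzero; \<open>Sum_any\<close> sums the
  nonzero terms of a finitely supported family.
\<close>

definition bch ::
  "('k::field_char_0 \<Rightarrow> 'v::ab_group_add \<Rightarrow> 'v) \<Rightarrow> ('v \<Rightarrow> 'v \<Rightarrow> 'v) \<Rightarrow> 'v \<Rightarrow> 'v \<Rightarrow> 'v"
  where "bch sV br x y = Sum_any (\<lambda>N. bch_component sV br N x y)"

definition gauge ::
  "('k::field_char_0 \<Rightarrow> 'v::ab_group_add \<Rightarrow> 'v) \<Rightarrow> ('v \<Rightarrow> 'v \<Rightarrow> 'v) \<Rightarrow> ('v \<Rightarrow> 'v) \<Rightarrow> 'v \<Rightarrow> 'v \<Rightarrow> 'v"
  where "gauge sV br d l x =
    x + Sum_any (\<lambda>n::nat. sV (1 / fact (n + 1)) ((br l ^^ n) (br l x - d l)))"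


section \<open>Deformation functors\<close>

text \<open>
  Notation for \<open>L \<otimes> m\<^sub>A\<close>: its graded pieces, bracket and differential, and the maps induced by a
  morphism \<open>\<epsilon>\<close> out of \<open>L\<close> and by a morphism \<open>\<phi>\<close> out of \<open>A\<close>. Elements \<open>e^\<alpha>\<close> of exponential
  groups are represented by \<open>\<alpha>\<close>.
\<close>

definition dg_m :: "('k::field, 'v::ab_group_add) dgla \<Rightarrow> ('k \<Rightarrow> 'a::comm_ring_1 \<Rightarrow> 'a) \<Rightarrow> int \<Rightarrow>
    ('k, 'v, 'a) tens set"
  where "dg_m L sA i = tensor_space (scl L) sA (deg L i) the_max"

definition lie_m :: "('k::field, 'v::ab_group_add) lie_alg \<Rightarrow> ('k \<Rightarrow> 'a::comm_ring_1 \<Rightarrow> 'a) \<Rightarrow>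
    ('k, 'v, 'a) tens set"
  where "lie_m \<gg> sA = tensor_space (lscl \<gg>) sA UNIV the_max"

abbreviation dg_brk :: "('k::field, 'v::ab_group_add) dgla \<Rightarrow> ('k \<Rightarrow> 'a::comm_ring_1 \<Rightarrow> 'a) \<Rightarrow>
    ('k, 'v, 'a) tens \<Rightarrow> ('k, 'v, 'a) tens \<Rightarrow> ('k, 'v, 'a) tens"
  where "dg_brk L sA \<equiv> tensor_bracket (scl L) sA (brk L)"

abbreviation dg_dif :: "('k::field, 'v::ab_group_add) dgla \<Rightarrow> ('k \<Rightarrow> 'a::comm_ring_1 \<Rightarrow> 'a) \<Rightarrow>
    ('k, 'v, 'a) tens \<Rightarrow> ('k, 'v, 'a) tens"
  where "dg_dif L sA \<equiv> tensor_map (scl L) sA (dif L) id"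

abbreviation dg_gauge :: "('k::field_char_0, 'v::ab_group_add) dgla \<Rightarrow>
    ('k \<Rightarrow> 'a::comm_ring_1 \<Rightarrow> 'a) \<Rightarrow> ('k, 'v, 'a) tens \<Rightarrow> ('k, 'v, 'a) tens \<Rightarrow> ('k, 'v, 'a) tens"
  where "dg_gauge L sA \<equiv> gauge tens_scale (dg_brk L sA) (dg_dif L sA)"

abbreviation dg_bch :: "('k::field_char_0, 'v::ab_group_add) dgla \<Rightarrow>
    ('k \<Rightarrow> 'a::comm_ring_1 \<Rightarrow> 'a) \<Rightarrow> ('k, 'v, 'a) tens \<Rightarrow> ('k, 'v, 'a) tens \<Rightarrow> ('k, 'v, 'a) tens"
  where "dg_bch L sA \<equiv> bch tens_scale (dg_brk L sA)"

abbreviation lie_bch :: "('k::field_char_0, 'v::ab_group_add) lie_alg \<Rightarrow>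
    ('k \<Rightarrow> 'a::comm_ring_1 \<Rightarrow> 'a) \<Rightarrow> ('k, 'v, 'a) tens \<Rightarrow> ('k, 'v, 'a) tens \<Rightarrow> ('k, 'v, 'a) tens"
  where "lie_bch \<gg> sA \<equiv> bch tens_scale (tensor_bracket (lscl \<gg>) sA (lbrk \<gg>))"

definition maurer_cartan :: "('k::field_char_0, 'v::ab_group_add) dgla \<Rightarrow>
    ('k \<Rightarrow> 'a::comm_ring_1 \<Rightarrow> 'a) \<Rightarrow> ('k, 'v, 'a) tens set"
  where "maurer_cartan L sA =
    {x \<in> dg_m L sA 1. dg_dif L sA x + tens_scale (1/2) (dg_brk L sA x x) = 0}"

subsection \<open>Eyssidieux--Simpson\<close>

definition ES_set :: "('k::field_char_0, 'l::ab_group_add) dgla \<Rightarrow> ('k, 'g::ab_group_add) lie_alg \<Rightarrow>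
    ('k \<Rightarrow> 'a::comm_ring_1 \<Rightarrow> 'a) \<Rightarrow> (('k, 'l, 'a) tens \<times> ('k, 'g, 'a) tens) set"
  where "ES_set L \<gg> sA = {(x, \<alpha>). x \<in> maurer_cartan L sA \<and> \<alpha> \<in> lie_m \<gg> sA}"

definition ES_act :: "('k::field_char_0, 'l::ab_group_add) dgla \<Rightarrow> ('k, 'g::ab_group_add) lie_alg \<Rightarrow>
    ('l \<Rightarrow> 'g) \<Rightarrow> ('k \<Rightarrow> 'a::comm_ring_1 \<Rightarrow> 'a) \<Rightarrow> ('k, 'l, 'a) tens \<Rightarrow>
    ('k, 'l, 'a) tens \<times> ('k, 'g, 'a) tens \<Rightarrow> ('k, 'l, 'a) tens \<times> ('k, 'g, 'a) tens"
  where "ES_act L \<gg> \<epsilon> sA l = (\<lambda>(x, \<alpha>).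
    (dg_gauge L sA l x, lie_bch \<gg> sA \<alpha> (- tensor_map (lscl \<gg>) sA \<epsilon> id l)))"

definition ES_rel :: "('k::field_char_0, 'l::ab_group_add) dgla \<Rightarrow> ('k, 'g::ab_group_add) lie_alg \<Rightarrow>
    ('l \<Rightarrow> 'g) \<Rightarrow> ('k \<Rightarrow> 'a::comm_ring_1 \<Rightarrow> 'a) \<Rightarrow>
    (('k, 'l, 'a) tens \<times> ('k, 'g, 'a) tens) rel"
  where "ES_rel L \<gg> \<epsilon> sA =
    {(p, q). p \<in> ES_set L \<gg> sA \<and> q \<in> ES_set L \<gg> sA \<and> (\<exists>l\<in>dg_m L sA 0. q = ES_act L \<gg> \<epsilon> sA l p)}"

definition Def_ES :: "('k::field_char_0, 'l::ab_group_add) dgla \<Rightarrow> ('k, 'g::ab_group_add) lie_alg \<Rightarrow>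
    ('l \<Rightarrow> 'g) \<Rightarrow> ('k \<Rightarrow> 'a::comm_ring_1 \<Rightarrow> 'a) \<Rightarrow>
    (('k, 'l, 'a) tens \<times> ('k, 'g, 'a) tens) set set"
  where "Def_ES L \<gg> \<epsilon> sA = ES_set L \<gg> sA // ES_rel L \<gg> \<epsilon> sA"

text \<open>
  A morphism \<open>\<phi>\<close> from \<open>A\<close> to \<open>B\<close> sends the class of \<open>(x, e^\<alpha>)\<close> to the class of
  \<open>((id \<otimes> \<phi>) x, e^((id \<otimes> \<phi>) \<alpha>))\<close>; the image of a class is written as the union of the classes
  of the images of all its members.
\<close>

definition Def_ES_map :: "('k::field_char_0, 'l::ab_group_add) dgla \<Rightarrow>
    ('k, 'g::ab_group_add) lie_alg \<Rightarrow> ('l \<Rightarrow> 'g) \<Rightarrow> ('k \<Rightarrow> 'b::comm_ring_1 \<Rightarrow> 'b) \<Rightarrow>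
    ('a::comm_ring_1 \<Rightarrow> 'b) \<Rightarrow>
    (('k, 'l, 'a) tens \<times> ('k, 'g, 'a) tens) set \<Rightarrow> (('k, 'l, 'b) tens \<times> ('k, 'g, 'b) tens) set"
  where "Def_ES_map L \<gg> \<epsilon> sB \<phi> C = ES_rel L \<gg> \<epsilon> sB ``
    (map_prod (tensor_map (scl L) sB id \<phi>) (tensor_map (lscl \<gg>) sB id \<phi>) ` C)"

subsection \<open>Fiorenza--Manetti\<close>

definition FM_set :: "('k::field_char_0, 'l::ab_group_add) dgla \<Rightarrow> ('k, 'm::ab_group_add) dgla \<Rightarrow>
    ('l \<Rightarrow> 'm) \<Rightarrow> ('k \<Rightarrow> 'a::comm_ring_1 \<Rightarrow> 'a) \<Rightarrow> (('k, 'l, 'a) tens \<times> ('k, 'm, 'a) tens) set"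
  where "FM_set L M \<epsilon> sA =
    {(x, \<alpha>). x \<in> maurer_cartan L sA \<and> \<alpha> \<in> dg_m M sA 0 \<and>
      dg_gauge M sA \<alpha> (tensor_map (scl M) sA \<epsilon> id x) = 0}"

definition FM_rel :: "('k::field_char_0, 'l::ab_group_add) dgla \<Rightarrow> ('k, 'm::ab_group_add) dgla \<Rightarrow>
    ('l \<Rightarrow> 'm) \<Rightarrow> ('k \<Rightarrow> 'a::comm_ring_1 \<Rightarrow> 'a) \<Rightarrow>
    (('k, 'l, 'a) tens \<times> ('k, 'm, 'a) tens) rel"
  where "FM_rel L M \<epsilon> sA =
    {((x, \<alpha>), (y, \<beta>)). (x, \<alpha>) \<in> FM_set L M \<epsilon> sA \<and> (y, \<beta>) \<in> FM_set L M \<epsilon> sA \<and>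
      (\<exists>l\<in>dg_m L sA 0. \<exists>\<mu>\<in>dg_m M sA (-1).
        dg_gauge L sA l x = y \<and>
        \<beta> = dg_bch M sA (dg_bch M sA (dg_dif M sA \<mu>) \<alpha>) (- tensor_map (scl M) sA \<epsilon> id l))}"

definition Def_FM :: "('k::field_char_0, 'l::ab_group_add) dgla \<Rightarrow> ('k, 'm::ab_group_add) dgla \<Rightarrow>
    ('l \<Rightarrow> 'm) \<Rightarrow> ('k \<Rightarrow> 'a::comm_ring_1 \<Rightarrow> 'a) \<Rightarrow>
    (('k, 'l, 'a) tens \<times> ('k, 'm, 'a) tens) set set"
  where "Def_FM L M \<epsilon> sA = FM_set L M \<epsilon> sA // FM_rel L M \<epsilon> sA"

definition Def_FM_map :: "('k::field_char_0, 'l::ab_group_add) dgla \<Rightarrow>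
    ('k, 'm::ab_group_add) dgla \<Rightarrow> ('l \<Rightarrow> 'm) \<Rightarrow> ('k \<Rightarrow> 'b::comm_ring_1 \<Rightarrow> 'b) \<Rightarrow>
    ('a::comm_ring_1 \<Rightarrow> 'b) \<Rightarrow>
    (('k, 'l, 'a) tens \<times> ('k, 'm, 'a) tens) set \<Rightarrow> (('k, 'l, 'b) tens \<times> ('k, 'm, 'b) tens) set"
  where "Def_FM_map L M \<epsilon> sB \<phi> C = FM_rel L M \<epsilon> sB ``
    (map_prod (tensor_map (scl L) sB id \<phi>) (tensor_map (scl M) sB id \<phi>) ` C)"

end

theory Submission
  imports Defs
begin

text \<open>
  The two functors are quotients of the same set by the same relation. Since \<open>\<gg>\<close> sits in degree
  zero with zero differential, \<open>\<epsilon>\<close> kills \<open>L\<^sup>1\<close>, so the condition \<open>e^\<alpha> * \<epsilon>(x) = 0\<close> reads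
  \<open>e^\<alpha> * 0 = 0\<close> and always holds; and \<open>d \<mu> = 0\<close>, so the factor \<open>e^(d \<mu>)\<close> is the unit of the
  group.
\<close>

section \<open>Tensors as linear combinations of pure tensors\<close>

lemma linear_zero_on_span:
  assumes "Vector_Spaces.linear s1 s2 f" "\<And>b. b \<in> B \<Longrightarrow> f b = 0" "x \<in> module.span s1 B"
  shows "f x = 0"
proof -
  interpret vector_space_pair s1 s2
    by (rule vector_space_pair.intro[OF linearD(3,4)[OF assms(1)]])
  show ?thesis by (rule linear_eq_on[OF assms(1) linear_zero assms(3)]) (use assms(2) in auto)
qed

lemma zero_in_tensor_space: "0 \<in> tensor_space sV sW V W"
proof -
  interpret vector_space tens_scale by (rule vector_space_tens_scale)
  show ?thesis unfolding tensor_space_def by (rule span_zero)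
qed

lemma pure_tensor_zero_left: "pure_tensor sV sW 0 w = 0"
proof -
  have "B 0 w = 0" if "bilin sV sW (*) B" for B
    using that linearD(5)[of sV "(*)" "\<lambda>v. B v w"] by (simp add: bilin_def)
  then show ?thesis by (simp add: pure_tensor_def fun_eq_iff)
qed

text \<open>The map is linear and kills every pure tensor with left factor in \<open>V\<close>. It
  serves for \<epsilon> on \<open>deg L 1\<close> and for the zero differential of \<gg>.\<close>

lemma tensor_map_eq_0:
  assumes f: "Vector_Spaces.linear sV sV' f" and g: "Vector_Spaces.linear sW sW' g"
    and "\<And>v. v \<in> V \<Longrightarrow> f v = 0" "t \<in> tensor_space sV sW V W"
  shows "tensor_map sV' sW' f g t = 0"
  by (rule linear_zero_on_span[OF linear_tensor_map _ assms(4)[unfolded tensor_space_def]])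
    (auto simp: tensor_map_pure[OF f g] assms(3) pure_tensor_zero_left)

text \<open>The left argument enters only by evaluation at a function, so linearity holds on the
  whole function type. The right argument is nested inside the left functional; there linearity
  requires genuine tensors.\<close>

lemma linear_tensor_bracket_left:
  "Vector_Spaces.linear tens_scale tens_scale (\<lambda>s. tensor_bracket sV sA br s t)"
  by (rule linearI'[OF vector_space_tens_scale vector_space_tens_scale])
    (simp_all add: tensor_bracket_def fun_eq_iff tens_scale_def)

lemma tensor_bracket_zero_left: "tensor_bracket sV sA br 0 t = 0"
  by (simp add: tensor_bracket_def fun_eq_iff)

text \<open>Span induction whose remainder \<open>t\<close> is again known to be a tensor, so that
  the linearity facts valid only for tensors apply inside the step.\<close>

lemma tensor_space_induct [consumes 1, case_names zero step]:
  assumes "t \<in> tensor_space sV sW V W" "P 0"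
    and "\<And>c v w t. v \<in> V \<Longrightarrow> w \<in> W \<Longrightarrow> t \<in> tensor_space sV sW V W \<Longrightarrow> P t \<Longrightarrow>
      P (tens_scale c (pure_tensor sV sW v w) + t)"
  shows "P t"
proof -
  interpret vector_space tens_scale by (rule vector_space_tens_scale)
  from assms(1) have "t \<in> tensor_space sV sW V W \<and> P t"
    unfolding tensor_space_def
  proof (rule span_induct_alt)
    show "0 \<in> span {pure_tensor sV sW v w |v w. v \<in> V \<and> w \<in> W} \<and> P 0"
      using assms(2) span_zero by blast
  next
    fix c x y
    assume "x \<in> {pure_tensor sV sW v w |v w. v \<in> V \<and> w \<in> W}"
      "y \<in> span {pure_tensor sV sW v w |v w. v \<in> V \<and> w \<in> W} \<and> P y"
    then show "tens_scale c x + y \<in> span {pure_tensor sV sW v w |v w. v \<in> V \<and> w \<in> W} \<and>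
        P (tens_scale c x + y)"
      using assms(3)[unfolded tensor_space_def] by (auto intro!: span_add span_scale intro: span_base)
  qed
  then show ?thesis by blast
qed

section \<open>The bracket on \<open>V \<otimes> A\<close> for a bilinear bracket on
  \<open>V\<close> and a commutative algebra \<open>A\<close>\<close>

context
  fixes sV :: "'k::field \<Rightarrow> 'v::ab_group_add \<Rightarrow> 'v" and sA :: "'k \<Rightarrow> 'a::comm_ring_1 \<Rightarrow> 'a"
    and br :: "'v \<Rightarrow> 'v \<Rightarrow> 'v"
  assumes br: "bilin sV sV sV br" and sA: "vector_space sA"
    and alg: "\<And>c a b. sA c (a * b) = sA c a * b"
begin

lemma mult_scale_right: "a * sA c b = sA c (a * b)"
  using alg[of c b a] by (simp add: mult.commute)

lemma bilinI:
  assumes "\<And>v v' w. f (v + v') w = f v w + f v' w" "\<And>v w w'. f v (w + w') = f v w + f v w'"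
    "\<And>c v w. f (sV c v) w = c * f v w" "\<And>c v w. f v (sA c w) = c * f v w"
  shows "bilin sV sA (*) f"
  unfolding bilin_def
  by (intro conjI allI linearI' sA bilinD(5)[OF br] vector_space_mult) (simp_all add: assms)

lemma bilin_lincomb:
  assumes "bilin sV sA (*) F" "bilin sV sA (*) G"
  shows "bilin sV sA (*) (\<lambda>v w. c * F v w + G v w)"
  by (rule bilinI) (simp_all add: bilinD[OF assms(1)] bilinD[OF assms(2)] algebra_simps)

lemma bilin_form_bracket:
  assumes B: "bilin sV sA (*) B"
  shows "bilin sV sA (*) (\<lambda>v b. B (br u v) (a * b))"
    and "bilin sV sA (*) (\<lambda>u a. B (br u v) (a * b))"
  by (rule bilinI; simp add: bilinD[OF B] bilinD[OF br] alg[symmetric] mult_scale_right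
      distrib_left distrib_right)+

text \<open>A pure tensor returns 0 on functions that are not bilinear forms. Bilinearity of the
  inner function is thus what allows the outer tensor of a bracket to be evaluated as
  expected.\<close>

lemma bilin_tensor_form_bracket:
  assumes "t \<in> tensor_space sV sA V W" and B: "bilin sV sA (*) B"
  shows "bilin sV sA (*) (\<lambda>u a. t (\<lambda>v b. B (br u v) (a * b)))"
  using assms(1)
proof (induction rule: tensor_space_induct)
  case zero
  show ?case by (rule bilinI) simp_all
next
  case (step c v w t)
  show ?case
    using bilin_lincomb[OF bilin_form_bracket(2)[OF B] step.IH]
    by (simp add: tens_scale_def pure_tensor_def bilin_form_bracket(1)[OF B])
qed

lemma tensor_bracket_linear_right:
  assumes "s \<in> tensor_space sV sA V W" "t \<in> tensor_space sV sA V W" "t' \<in> tensor_space sV sA V W"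
  shows "tensor_bracket sV sA br s (tens_scale c t + t') =
    tens_scale c (tensor_bracket sV sA br s t) + tensor_bracket sV sA br s t'"
proof
  fix B
  \<comment> \<open>A tensor is a combination of evaluations at points, hence linear on bilinear
    forms, although not on arbitrary functions.\<close>
  have add: "s (\<lambda>u a. c * F u a + G u a) = c * s F + s G"
    if "bilin sV sA (*) F" "bilin sV sA (*) G" for F G
    using assms(1)
  proof (induction rule: tensor_space_induct)
    case (step d v w s)
    from step.IH that bilin_lincomb[OF that] show ?case
      by (simp add: tens_scale_def pure_tensor_def algebra_simps)
  qed simp
  show "tensor_bracket sV sA br s (tens_scale c t + t') B =
    (tens_scale c (tensor_bracket sV sA br s t) + tensor_bracket sV sA br s t') B"
    using add bilin_tensor_form_bracket assms(2,3) by (simp add: tensor_bracket_def tens_scale_def)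
qed

lemma tensor_bracket_zero_right:
  assumes "s \<in> tensor_space sV sA V W"
  shows "tensor_bracket sV sA br s 0 = 0"
  by (rule linear_zero_on_span[OF linear_tensor_bracket_left _ assms[unfolded tensor_space_def]])
    (auto simp: tensor_bracket_def pure_tensor_def fun_eq_iff)

text \<open>Adding one pure tensor \<open>p\<close> at a time, \<open>[c p + s, c p + s]\<close> is
  \<open>c^2 [p, p] + c ([p, s] + [s, p]) + [s, s]\<close>. The first term vanishes since
  \<open>br u u = 0\<close>, the second by antisymmetry, the third by induction.\<close>

lemma tensor_bracket_alternating:
  assumes alt: "\<And>v. br v v = 0" and "s \<in> tensor_space sV sA V W"
  shows "tensor_bracket sV sA br s s = 0"
  using assms(2)
proof (induction rule: tensor_space_induct)
  case zero
  show ?case by (rule tensor_bracket_zero_left)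
next
  case (step c u a s)
  let ?b = "tensor_bracket sV sA br" and ?p = "pure_tensor sV sA"
  note lin_left = linearD(1,2)[OF linear_tensor_bracket_left]
  note pure = tensor_bracket_pure[OF br sA alg]
  interpret T: vector_space "tens_scale :: 'k \<Rightarrow> _ \<Rightarrow> ('k, 'v, 'a) tens"
    by (rule vector_space_tens_scale)
  have p: "?p v b \<in> tensor_space sV sA V W" if "v \<in> V" "b \<in> W" for v b
    unfolding tensor_space_def using that by (blast intro: T.span_base)
  \<comment> \<open>Polarization of \<open>br (u + v) (u + v) = 0\<close>.\<close>
  have anti_br: "br u v + br v u = 0" for u v
    using alt[of "u + v", unfolded bilinD(1,2)[OF br]] by (simp add: alt add.commute)
  have pure_eq_0: "?p (br u u) b = 0" for u b by (simp add: alt pure_tensor_zero_left)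
  \<comment> \<open>Antisymmetry against a fixed pure tensor, by a second induction. Commutativity
    of \<open>A\<close> gives both brackets of pure tensors the same right factor
    \<open>a * b\<close>.\<close>
  have anti: "?b (?p u a) t + ?b t (?p u a) = 0" if "t \<in> tensor_space sV sA V W" for t
    using that
  proof (induction rule: tensor_space_induct)
    case zero
    show ?case
      by (simp only: tensor_bracket_zero_left tensor_bracket_zero_right[OF p[OF step.hyps(1,2)]] add_0)
  next
    case (step d v b t)
    have "?b (?p u a) (?p v b) + ?b (?p v b) (?p u a) = ?p (br u v + br v u) (a * b)"
      by (simp add: pure mult.commute[of b a] bilinD(1)[OF bilin_pure_tensor[OF bilinD(5)[OF br] sA]])
    then have *: "?b (?p u a) (?p v b) + ?b (?p v b) (?p u a) = 0"
      by (simp only: anti_br pure_tensor_zero_left)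
    have "?b (?p u a) (tens_scale d (?p v b) + t) + ?b (tens_scale d (?p v b) + t) (?p u a) =
        tens_scale d (?b (?p u a) (?p v b) + ?b (?p v b) (?p u a)) + (?b (?p u a) t + ?b t (?p u a))"
      by (simp only: lin_left T.scale_right_distrib
          tensor_bracket_linear_right[OF p[OF \<open>u \<in> V\<close> \<open>a \<in> W\<close>] p[OF step.hyps(1,2)] step.hyps(3)])
        (simp only: add_ac)
    then show ?case by (simp only: * step.IH) (simp add: T.scale_zero_right)
  qed
  have "?b (tens_scale c (?p u a) + s) (tens_scale c (?p u a) + s) =
      tens_scale c (tens_scale c (?b (?p u a) (?p u a))) +
      tens_scale c (?b (?p u a) s + ?b s (?p u a)) + ?b s s"
    by (simp only: lin_left T.scale_right_distrib
        tensor_bracket_linear_right[OF _ p[OF step.hyps(1,2)] step.hyps(3)]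
        p[OF step.hyps(1,2)] step.hyps(3))
      (simp only: add_ac)
  then show ?case
    by (simp only: anti[OF step.hyps(3)] step.IH pure pure_eq_0) (simp add: T.scale_zero_right)
qed

end

section \<open>The BCH product and the gauge action at zero\<close>

lemma nested_bracket_two_letters_eq_0:
  assumes "\<And>z. br 0 z = 0" "br y 0 = 0" "br y y = 0"
    and "set ws \<subseteq> {0, y}" "length ws \<noteq> 1"
  shows "nested_bracket br ws = 0"
  using assms(4,5)
proof (induction ws)
  case (Cons x ws)
  show ?case
  proof (cases ws)
    case Nil
    with Cons.prems show ?thesis by simp
  next
    case (Cons z zs)
    \<comment> \<open>A one-letter tail gives that letter, a longer one gives 0 by induction. The
      outermost bracket is therefore among the three forms assumed to vanish.\<close>
    have "nested_bracket br ws \<in> {0, y}"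
      using Cons.IH Cons.prems \<open>ws = z # zs\<close> by (cases zs) auto
    with Cons.prems assms(1-3) \<open>ws = z # zs\<close> show ?thesis by auto
  qed
qed simp

text \<open>In Dynkin's formula every word is made of the letters 0 and \<open>y\<close>, and its
  length is the degree \<open>N\<close>. Only one-letter words can contribute, so just the component
  of degree 1 survives.\<close>

lemma bch_zero_left:
  assumes "vector_space sV" "\<And>z. br 0 z = 0" "br y 0 = 0" "br y y = 0"
  shows "bch sV br 0 y = y"
proof -
  interpret vector_space sV by fact
  define word where "word ps = concat (map (\<lambda>(r, s). replicate r 0 @ replicate s y) ps)"
    for ps :: "(nat \<times> nat) list"
  define I where "I N = {ps :: (nat \<times> nat) list. (0, 0) \<notin> set ps \<and> (\<Sum>(r, s)\<leftarrow>ps. r + s) = N}" for N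
  have len: "length (word ps) = (\<Sum>(r, s)\<leftarrow>ps. r + s)" for ps
    by (induction ps) (auto simp: word_def)
  have letters: "set (word ps) \<subseteq> {0, y}" for ps
    by (auto simp: word_def set_replicate_conv_if split: if_splits)
  have "bch_component sV br N 0 y = 0" if "N \<noteq> 1" for N
    unfolding bch_component_def word_def[symmetric] I_def[symmetric]
  proof (intro sum.neutral ballI)
    fix ps assume "ps \<in> I N"
    then have "nested_bracket br (word ps) = 0"
      using nested_bracket_two_letters_eq_0[of br, OF assms(2-4) letters] len that by (auto simp: I_def)
    then show "sV ((-1) ^ (length ps - 1) / (of_nat (length ps) * of_nat N *
        (\<Prod>(r, s)\<leftarrow>ps. fact r * fact s))) (nested_bracket br (word ps)) = 0" by simp
  qed
  then have "bch sV br 0 y = bch_component sV br 1 0 y"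
    unfolding bch_def by (subst Sum_any.expand_superset[of "{1}"]) auto
  \<comment> \<open>These two lists are the words \<open>y\<close> and 0, each with coefficient
    1.\<close>
  also have "I 1 = {[(0, 1)], [(1, 0)]}"
  proof
    show "I 1 \<subseteq> {[(0, 1)], [(1, 0)]}"
    proof
      fix ps assume "ps \<in> I 1"
      then show "ps \<in> {[(0, 1)], [(1, 0)]}"
        by (cases ps; cases "tl ps") (auto simp: I_def add_is_1)
    qed
  qed (auto simp: I_def)
  then have "bch_component sV br 1 0 y = y"
    unfolding bch_component_def I_def[symmetric] by simp
  finally show ?thesis .
qed

text \<open>The seed \<open>[l, 0] - d l\<close> of the gauge series is 0, and \<open>br l\<close>
  keeps it at 0.\<close>

lemma gauge_zero:
  assumes "vector_space sV" "br l 0 = 0" "d l = 0"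
  shows "gauge sV br d l 0 = 0"
proof -
  interpret vector_space sV by fact
  have "(br l ^^ n) 0 = 0" for n by (induction n) (simp_all add: assms(2))
  then show ?thesis by (simp add: gauge_def assms(2,3))
qed

section \<open>Comparison of the two functors\<close>

lemma dg_of_lie_simps [simp]:
  "scl (dg_of_lie \<gg>) = lscl \<gg>" "deg (dg_of_lie \<gg>) i = (if i = 0 then UNIV else {0})"
  "brk (dg_of_lie \<gg>) = lbrk \<gg>" "dif (dg_of_lie \<gg>) = (\<lambda>_. 0)"
  by (simp_all add: dg_of_lie_def)

lemma local_artin_algebraD:
  assumes "local_artin_algebra sA"
  shows "vector_space sA" "sA c (a * b) = sA c a * b"
  using assms by (auto simp: local_artin_algebra_def finite_dimensional_vector_space_def)

lemma lie_algebraD: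
  assumes "lie_algebra \<gg>"
  shows "vector_space (lscl \<gg>)" "bilin (lscl \<gg>) (lscl \<gg>) (lscl \<gg>) (lbrk \<gg>)" "lbrk \<gg> x x = 0"
  using assms by (auto simp: lie_algebra_def)

text \<open>With \<open>V\<close> left free, this covers both the exponents \<alpha> in degree 0 and
  the elements \<mu> in degree -1.\<close>

lemma dg_dif_dg_of_lie:
  assumes "lie_algebra \<gg>" "local_artin_algebra sA" "t \<in> tensor_space (lscl \<gg>) sA V W"
  shows "dg_dif (dg_of_lie \<gg>) sA t = 0"
proof -
  interpret vector_space "lscl \<gg>" by (rule lie_algebraD(1)[OF assms(1)])
  have "Vector_Spaces.linear (lscl \<gg>) (lscl \<gg>) (\<lambda>_. 0)" "Vector_Spaces.linear sA sA id"
    using lie_algebraD(1)[OF assms(1)] local_artin_algebraD(1)[OF assms(2)]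
    by (auto intro!: linearI')
  from tensor_map_eq_0[OF this _ assms(3)] show ?thesis by simp
qed

lemma FM_set_eq_ES_set:
  assumes \<gg>: "lie_algebra \<gg>" and \<epsilon>: "dg_lie_hom L (dg_of_lie \<gg>) \<epsilon>" and sA: "local_artin_algebra sA"
  shows "FM_set L (dg_of_lie \<gg>) \<epsilon> sA = ES_set L \<gg> sA"
proof -
  have "dg_gauge (dg_of_lie \<gg>) sA \<alpha> (tensor_map (lscl \<gg>) sA \<epsilon> id x) = 0"
    if x: "x \<in> maurer_cartan L sA" and \<alpha>: "\<alpha> \<in> lie_m \<gg> sA" for x \<alpha>
  proof -
    \<comment> \<open>A morphism preserves degrees, and the degree 1 part of
      \<open>dg_of_lie \<gg>\<close> is \<open>{0}\<close>.\<close>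
    have "Vector_Spaces.linear (scl L) (lscl \<gg>) \<epsilon>" "\<And>v. v \<in> deg L 1 \<Longrightarrow> \<epsilon> v = 0"
      using \<epsilon> zero_neq_one by (fastforce simp: dg_lie_hom_def)+
    moreover have "Vector_Spaces.linear sA sA id"
      using local_artin_algebraD(1)[OF sA] by (auto intro!: linearI')
    moreover have "x \<in> tensor_space (scl L) sA (deg L 1) the_max"
      using x by (simp add: maurer_cartan_def dg_m_def)
    ultimately have "tensor_map (lscl \<gg>) sA \<epsilon> id x = 0" using tensor_map_eq_0 by blast
    moreover have "dg_gauge (dg_of_lie \<gg>) sA \<alpha> 0 = 0"
      using \<alpha> dg_dif_dg_of_lie[OF \<gg> sA]
      by (intro gauge_zero vector_space_tens_scale)
        (auto simp: lie_m_def intro!: tensor_bracket_zero_right lie_algebraD[OF \<gg>]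
          local_artin_algebraD[OF sA])
    ultimately show ?thesis by simp
  qed
  then show ?thesis by (auto simp: FM_set_def ES_set_def dg_m_def lie_m_def)
qed

lemma FM_rel_eq_ES_rel:
  assumes \<gg>: "lie_algebra \<gg>" and \<epsilon>: "dg_lie_hom L (dg_of_lie \<gg>) \<epsilon>" and sA: "local_artin_algebra sA"
  shows "FM_rel L (dg_of_lie \<gg>) \<epsilon> sA = ES_rel L \<gg> \<epsilon> sA"
proof -
  have bch: "lie_bch \<gg> sA (dg_dif (dg_of_lie \<gg>) sA \<mu>) \<alpha> = \<alpha>"
    if \<mu>: "\<mu> \<in> dg_m (dg_of_lie \<gg>) sA (-1)" and \<alpha>: "\<alpha> \<in> lie_m \<gg> sA" for \<mu> \<alpha>
  proof -
    have "dg_dif (dg_of_lie \<gg>) sA \<mu> = 0"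
      by (rule dg_dif_dg_of_lie[OF \<gg> sA \<mu>[unfolded dg_m_def dg_of_lie_simps(1)]])
    moreover have "lie_bch \<gg> sA 0 \<alpha> = \<alpha>"
      using \<alpha> unfolding lie_m_def
      by (intro bch_zero_left vector_space_tens_scale tensor_bracket_zero_left
          tensor_bracket_zero_right tensor_bracket_alternating lie_algebraD[OF \<gg>]
          local_artin_algebraD[OF sA])
    ultimately show ?thesis by simp
  qed
  \<comment> \<open>The witness for \<mu> when an ES relation is read as an FM relation.\<close>
  have "0 \<in> dg_m (dg_of_lie \<gg>) sA (-1)" unfolding dg_m_def by (rule zero_in_tensor_space)
  then show ?thesis
    unfolding FM_rel_def ES_rel_def ES_act_def FM_set_eq_ES_set[OF assms]
    using bch by (fastforce simp: ES_set_def)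
qed

theorem lemma5p3:
  fixes L :: "('k::field_char_0, 'l::ab_group_add) dgla"
    and \<gg> :: "('k, 'g::ab_group_add) lie_alg"
    and \<epsilon> :: "'l \<Rightarrow> 'g"
    and sA :: "'k \<Rightarrow> 'a::comm_ring_1 \<Rightarrow> 'a"
  assumes "dg_lie_algebra L"
    and "lie_algebra \<gg>"
    and "dg_lie_hom L (dg_of_lie \<gg>) \<epsilon>"
    and "local_artin_algebra sA"
  shows "Def_FM L (dg_of_lie \<gg>) \<epsilon> sA = Def_ES L \<gg> \<epsilon> sA \<and>
    (\<forall>(sB :: 'k \<Rightarrow> 'b::comm_ring_1 \<Rightarrow> 'b) \<phi>.
      local_artin_algebra sB \<and> local_artin_hom sA sB \<phi> \<longrightarrow>
      (\<forall>C \<in> Def_FM L (dg_of_lie \<gg>) \<epsilon> sA.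
        Def_FM_map L (dg_of_lie \<gg>) \<epsilon> sB \<phi> C = Def_ES_map L \<gg> \<epsilon> sB \<phi> C))"
  \<comment> \<open>The quotients agree by equality of sets and relations over \<open>sA\<close>.
    The maps on classes apply the same tensor maps and then saturate by relations over
    \<open>sB\<close>, which are equal for the same reason.\<close>
  using assms(2-4)
  by (simp add: Def_FM_def Def_ES_def Def_FM_map_def Def_ES_map_def FM_set_eq_ES_set
      FM_rel_eq_ES_rel)

end
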